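(* For a $d$-space $X$, the following conditions are equivalent: (1) $X$ is sober. (2) For each irreducible closed subset $A$ of $X$ and each $K\in\mathbf{up}(X)$: $\Psi_{\mathbf{up}(X)}(A)$ is a filter of $\mathbf{up}(X)$ and $\mathord{\downarrow}(A\cap K)$ is closed in $X$. (3) For each irreducible closed subset $A$ of $X$ and each $K\in\mathsf{K}(X)$: $\Psi_{\mathsf{K}(X)}(A)$ is a filter of $\mathsf{K}(X)$ and $\mathord{\downarrow}(A\cap K)$ is closed in $X$.
   Context: A $T_0$ space $X$ is regarded as a poset under its specialization order: $x\leq y$ iff $x\in\overline{\{y\}}$; $\mathord{\downarrow}$ denotes lower closure in this order. A dcpo is a poset in which every (nonempty) directed subset has a supremum; a subset $U$ of a poset is Scott open if it is an upper set and, for every directed $D$ whose supremum exists, $\bigvee D\in U$ implies $D\cap U\ne\emptyset$. A $T_0$ space $X$ is a $d$-space if it is a dcpo in its specialization order and every open set is Scott open. $\mathbf{up}(X)$ is the set of all nonempty upper subsets of $X$, and $\mathsf{K}(X)$ is the set of all nonempty compact saturated subsets of $X$ (saturated = intersection of open sets = upper set). Both are ordered by set inclusion $\subseteq$; a filter of such a poset is a nonempty subset that is upward closed and in which any two elements have a lower bound belonging to the subset. For $A\subseteq X$, $\Psi_{\mathbf{up}(X)}(A)=\{K\in\mathbf{up}(X):K\cap A\neq\emptyset\}$ and $\Psi_{\mathsf{K}(X)}(A)=\{K\in\mathsf{K}(X):K\cap A\neq\emptyset\}$. A nonempty set $A$ is irreducible if $A\subseteq F_1\cup F_2$ with $F_1,F_2$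 closed implies $A\subseteq F_1$ or $A\subseteq F_2$. $X$ is sober if every irreducible closed set is $\overline{\{a\}}$ for a unique point $a\in X$. *)

theory Defs
  imports "HOL-Analysis.Analysis"
begin

section \<open>Posets, given by a carrier set and a binary relation\<close>

definition poset_on :: "'a set \<Rightarrow> ('a \<Rightarrow> 'a \<Rightarrow> bool) \<Rightarrow> bool" where
  "poset_on P le \<longleftrightarrow> reflp_on P le \<and> transp_on P le \<and> antisymp_on P le"

definition directed_on :: "'a set \<Rightarrow> ('a \<Rightarrow> 'a \<Rightarrow> bool) \<Rightarrow> 'a set \<Rightarrow> bool" where
  "directed_on P le D \<longleftrightarrow>
     D \<subseteq> P \<and> D \<noteq> {} \<and> (\<forall>x\<in>D. \<forall>y\<in>D. \<exists>z\<in>D. le x z \<and> le y z)"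

definition is_sup_on :: "'a set \<Rightarrow> ('a \<Rightarrow> 'a \<Rightarrow> bool) \<Rightarrow> 'a set \<Rightarrow> 'a \<Rightarrow> bool" where
  "is_sup_on P le D s \<longleftrightarrow>
     s \<in> P \<and> (\<forall>x\<in>D. le x s) \<and> (\<forall>u\<in>P. (\<forall>x\<in>D. le x u) \<longrightarrow> le s u)"

definition dcpo_on :: "'a set \<Rightarrow> ('a \<Rightarrow> 'a \<Rightarrow> bool) \<Rightarrow> bool" where
  "dcpo_on P le \<longleftrightarrow>
     poset_on P le \<and> (\<forall>D. directed_on P le D \<longrightarrow> (\<exists>s. is_sup_on P le D s))"

definition upper_set_on :: "'a set \<Rightarrow> ('a \<Rightarrow> 'a \<Rightarrow> bool) \<Rightarrow> 'a set \<Rightarrow> bool" where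
  "upper_set_on P le U \<longleftrightarrow> U \<subseteq> P \<and> (\<forall>x\<in>U. \<forall>y\<in>P. le x y \<longrightarrow> y \<in> U)"

definition lower_closure_on :: "'a set \<Rightarrow> ('a \<Rightarrow> 'a \<Rightarrow> bool) \<Rightarrow> 'a set \<Rightarrow> 'a set" where
  "lower_closure_on P le A = {x \<in> P. \<exists>a\<in>A. le x a}"

definition scott_open_on :: "'a set \<Rightarrow> ('a \<Rightarrow> 'a \<Rightarrow> bool) \<Rightarrow> 'a set \<Rightarrow> bool" where
  "scott_open_on P le U \<longleftrightarrow>
     upper_set_on P le U \<and>
     (\<forall>D s. directed_on P le D \<and> is_sup_on P le D s \<and> s \<in> U \<longrightarrow> D \<inter> U \<noteq> {})"

text \<open>An order-theoretic filter of a poset. Unlike the filters on a set (type \<open>'a filter\<close>) it need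
  not be proper.\<close>

definition poset_filter_on :: "'a set \<Rightarrow> ('a \<Rightarrow> 'a \<Rightarrow> bool) \<Rightarrow> 'a set \<Rightarrow> bool" where
  "poset_filter_on P le F \<longleftrightarrow>
     F \<noteq> {} \<and> upper_set_on P le F \<and> (\<forall>x\<in>F. \<forall>y\<in>F. \<exists>z\<in>F. le z x \<and> le z y)"

section \<open>Spaces ordered by specialization\<close>

definition spec_le :: "'a topology \<Rightarrow> 'a \<Rightarrow> 'a \<Rightarrow> bool" where
  "spec_le X x y \<longleftrightarrow> x \<in> X closure_of {y}"

definition d_space :: "'a topology \<Rightarrow> bool" where
  "d_space X \<longleftrightarrow>
     t0_space X \<and> dcpo_on (topspace X) (spec_le X) \<and>
     (\<forall>U. openin X U \<longrightarrow> scott_open_on (topspace X) (spec_le X) U)"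

definition irreducible_in :: "'a topology \<Rightarrow> 'a set \<Rightarrow> bool" where
  "irreducible_in X A \<longleftrightarrow>
     A \<subseteq> topspace X \<and> A \<noteq> {} \<and>
     (\<forall>F1 F2. closedin X F1 \<and> closedin X F2 \<and> A \<subseteq> F1 \<union> F2 \<longrightarrow> A \<subseteq> F1 \<or> A \<subseteq> F2)"

definition sober_space :: "'a topology \<Rightarrow> bool" where
  "sober_space X \<longleftrightarrow>
     (\<forall>A. irreducible_in X A \<and> closedin X A \<longrightarrow> (\<exists>!a. a \<in> topspace X \<and> A = X closure_of {a}))"

text \<open>The factor \<^term>\<open>topspace X\<close> accounts for the intersection of the empty family, which is
  the whole space and not \<^term>\<open>UNIV\<close>.\<close>

definition saturated_in :: "'a topology \<Rightarrow> 'a set \<Rightarrow> bool" where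
  "saturated_in X S \<longleftrightarrow> (\<exists>\<U>. (\<forall>U\<in>\<U>. openin X U) \<and> S = topspace X \<inter> \<Inter>\<U>)"

definition up_sets :: "'a topology \<Rightarrow> 'a set set" where
  "up_sets X = {K. K \<noteq> {} \<and> upper_set_on (topspace X) (spec_le X) K}"

definition compact_saturated_sets :: "'a topology \<Rightarrow> 'a set set" where
  "compact_saturated_sets X = {K. K \<noteq> {} \<and> compactin X K \<and> saturated_in X K}"

text \<open>\<open>Psi H A\<close> is $\Psi_H(A)$, for a family \<open>H\<close> of subsets of the space.\<close>

definition Psi :: "'a set set \<Rightarrow> 'a set \<Rightarrow> 'a set set" where
  "Psi H A = {K \<in> H. K \<inter> A \<noteq> {}}"

end

theory Submission
  imports Defs
begin

text \<open>
  Both equivalences are instances of one statement about a family \<open>H\<close> of nonempty upper sets that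
  contains every principal upper set \<open>\<up>x\<close>; both the family of all nonempty upper sets and that of
  the nonempty compact saturated sets are of this kind.

  In a sober space an irreducible closed set is \<open>\<down>a\<close> for a point \<open>a\<close>, and an upper set \<open>K\<close> meets
  \<open>\<down>a\<close> iff \<open>a \<in> K\<close>. So the members of \<open>H\<close> meeting \<open>\<down>a\<close> form the principal filter generated by
  \<open>\<up>a\<close>, and \<open>\<down>(\<down>a \<inter> K)\<close> is either \<open>\<down>a\<close> or empty.

  Conversely, let the members of \<open>H\<close> that meet the irreducible closed set \<open>A\<close> form a filter. For
  \<open>x\<close> and \<open>y\<close> in \<open>A\<close>, a lower bound of \<open>\<up>x\<close> and \<open>\<up>y\<close> in this filter contains a point of \<open>A\<close>, which
  is an upper bound of \<open>x\<close> and \<open>y\<close>. Hence \<open>A\<close> is directed. In a \<open>d\<close>-space closed sets are closed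
  under directed suprema, so \<open>A\<close> contains its supremum \<open>s\<close> and equals \<open>\<down>s\<close>.
\<close>

lemma spec_le_iff_openin:
  "spec_le X x y \<longleftrightarrow> x \<in> topspace X \<and> (\<forall>U. openin X U \<longrightarrow> x \<in> U \<longrightarrow> y \<in> U)"
  by (auto simp: spec_le_def in_closure_of)

lemma spec_le_refl: "x \<in> topspace X \<Longrightarrow> spec_le X x x"
  by (simp add: spec_le_iff_openin)

lemma spec_le_trans: "spec_le X x y \<Longrightarrow> spec_le X y z \<Longrightarrow> spec_le X x z"
  by (simp add: spec_le_iff_openin)

lemma spec_le_topspace: "spec_le X x y \<Longrightarrow> x \<in> topspace X \<and> y \<in> topspace X"
  using openin_topspace[of X] unfolding spec_le_iff_openin by blast

lemma spec_le_antisym: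
  assumes "t0_space X" "spec_le X x y" "spec_le X y x"
  shows "x = y"
proof (rule ccontr)
  assume "x \<noteq> y"
  moreover have "x \<in> topspace X" "y \<in> topspace X"
    using assms by (simp_all add: spec_le_iff_openin)
  ultimately obtain U where "openin X U" "\<not> (x \<in> U \<longleftrightarrow> y \<in> U)"
    using assms(1) unfolding t0_space_def by blast
  with assms(2,3) show False
    by (auto simp: spec_le_iff_openin)
qed

lemma closedin_lower:
  assumes "closedin X A" "y \<in> A" "spec_le X x y"
  shows "x \<in> A"
  using assms closure_of_minimal[of "{y}" A X] by (auto simp: spec_le_def)

lemma principal_upper_in_up_sets:
  "x \<in> topspace X \<Longrightarrow> {y. spec_le X x y} \<in> up_sets X"
  unfolding up_sets_def upper_set_on_def
  by (auto intro: spec_le_refl spec_le_trans dest: spec_le_topspace)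

text \<open>Any open set containing \<open>x\<close> already covers \<open>\<up>x\<close>, which gives compactness; and \<open>\<up>x\<close> is the
  intersection of all these open sets.\<close>

lemma principal_upper_in_compact_saturated_sets:
  assumes x: "x \<in> topspace X"
  shows "{y. spec_le X x y} \<in> compact_saturated_sets X"
proof -
  have "compactin X {y. spec_le X x y}"
    unfolding compactin_def
  proof (intro conjI allI impI)
    show "{y. spec_le X x y} \<subseteq> topspace X"
      by (auto dest: spec_le_topspace)
  next
    fix \<U> assume cover: "(\<forall>U\<in>\<U>. openin X U) \<and> {y. spec_le X x y} \<subseteq> \<Union>\<U>"
    then obtain U where U: "U \<in> \<U>" "x \<in> U"
      using spec_le_refl[OF x] by blast
    then have "{y. spec_le X x y} \<subseteq> \<Union>{U}"
      using cover by (auto simp: spec_le_iff_openin)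
    with U show "\<exists>\<F>. finite \<F> \<and> \<F> \<subseteq> \<U> \<and> {y. spec_le X x y} \<subseteq> \<Union>\<F>"
      by (intro exI[of _ "{U}"]) auto
  qed
  moreover have "{y. spec_le X x y} = topspace X \<inter> \<Inter>{U. openin X U \<and> x \<in> U}"
  proof (intro equalityI subsetI)
    fix y assume "y \<in> {y. spec_le X x y}"
    then show "y \<in> topspace X \<inter> \<Inter>{U. openin X U \<and> x \<in> U}"
      using spec_le_topspace[of X x y] by (simp add: spec_le_iff_openin)
  next
    fix y assume "y \<in> topspace X \<inter> \<Inter>{U. openin X U \<and> x \<in> U}"
    with x show "y \<in> {y. spec_le X x y}"
      by (simp add: spec_le_iff_openin)
  qed
  then have "saturated_in X {y. spec_le X x y}"
    unfolding saturated_in_def by (intro exI[of _ "{U. openin X U \<and> x \<in> U}"]) simp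
  ultimately show ?thesis
    using spec_le_refl[OF x] by (auto simp: compact_saturated_sets_def)
qed

lemma compact_saturated_sets_subset_up_sets: "compact_saturated_sets X \<subseteq> up_sets X"
  by (auto simp: compact_saturated_sets_def up_sets_def saturated_in_def upper_set_on_def
      spec_le_iff_openin)

lemma upper_set_meets_principal_closure_iff:
  assumes "K \<in> up_sets X" "a \<in> topspace X"
  shows "K \<inter> X closure_of {a} \<noteq> {} \<longleftrightarrow> a \<in> K"
proof
  assume "K \<inter> X closure_of {a} \<noteq> {}"
  then obtain x where "x \<in> K" "spec_le X x a"
    by (auto simp: spec_le_def)
  with assms show "a \<in> K"
    by (auto simp: up_sets_def upper_set_on_def)
next
  assume "a \<in> K"
  with assms show "K \<inter> X closure_of {a} \<noteq> {}"
    using spec_le_refl[of a X] by (auto simp: spec_le_def)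
qed

lemma poset_filter_Psi_principal_closure:
  assumes H: "H \<subseteq> up_sets X" and pr: "{y. spec_le X a y} \<in> H" and a: "a \<in> topspace X"
  shows "poset_filter_on H (\<subseteq>) (Psi H (X closure_of {a}))"
proof -
  have Psi_eq: "Psi H (X closure_of {a}) = {K \<in> H. a \<in> K}"
    using H upper_set_meets_principal_closure_iff[OF _ a] unfolding Psi_def by blast
  have least: "{y. spec_le X a y} \<subseteq> K" if "K \<in> H" "a \<in> K" for K
    using that H spec_le_topspace[of X a] by (auto simp: up_sets_def upper_set_on_def)
  show ?thesis
    unfolding poset_filter_on_def Psi_eq upper_set_on_def
    using pr spec_le_refl[OF a] least by blast
qed

lemma closedin_lower_closure_principal_closure_Int:
  assumes K: "K \<in> up_sets X" and a: "a \<in> topspace X"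
  shows "closedin X (lower_closure_on (topspace X) (spec_le X) (X closure_of {a} \<inter> K))"
proof (cases "a \<in> K")
  case True
  have "lower_closure_on (topspace X) (spec_le X) (X closure_of {a} \<inter> K) = X closure_of {a}"
  proof (intro equalityI subsetI)
    fix x assume "x \<in> lower_closure_on (topspace X) (spec_le X) (X closure_of {a} \<inter> K)"
    then show "x \<in> X closure_of {a}"
      using closedin_lower[OF closedin_closure_of] by (auto simp: lower_closure_on_def)
  next
    fix x assume "x \<in> X closure_of {a}"
    then have "spec_le X x a"
      by (simp add: spec_le_def)
    moreover have "a \<in> X closure_of {a}"
      using spec_le_refl[OF a] by (simp add: spec_le_def)
    ultimately show "x \<in> lower_closure_on (topspace X) (spec_le X) (X closure_of {a} \<inter> K)"
      using True spec_le_topspace[of X x a] by (auto simp: lower_closure_on_def)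
  qed
  then show ?thesis by simp
next
  case False
  then have "X closure_of {a} \<inter> K = {}"
    using upper_set_meets_principal_closure_iff[OF K a] by blast
  then show ?thesis
    by (simp add: lower_closure_on_def)
qed

lemma directed_on_if_Psi_filter:
  assumes pr: "\<And>x. x \<in> topspace X \<Longrightarrow> {y. spec_le X x y} \<in> H"
    and A: "A \<subseteq> topspace X" "A \<noteq> {}"
    and filt: "poset_filter_on H (\<subseteq>) (Psi H A)"
  shows "directed_on (topspace X) (spec_le X) A"
proof -
  have mem: "{y. spec_le X x y} \<in> Psi H A" if "x \<in> A" for x
    using that A pr[of x] spec_le_refl[of x X] by (auto simp: Psi_def)
  have "\<exists>z\<in>A. spec_le X x z \<and> spec_le X y z" if xy: "x \<in> A" "y \<in> A" for x y
  proof -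
    obtain K where "K \<in> Psi H A" "K \<subseteq> {z. spec_le X x z}" "K \<subseteq> {z. spec_le X y z}"
      using filt mem[OF xy(1)] mem[OF xy(2)] unfolding poset_filter_on_def by meson
    then show ?thesis
      by (auto simp: Psi_def)
  qed
  with A show ?thesis
    by (simp add: directed_on_def)
qed

lemma d_space_sup_in_closedin:
  assumes X: "d_space X" and A: "closedin X A"
    and D: "directed_on (topspace X) (spec_le X) D" "D \<subseteq> A"
    and s: "is_sup_on (topspace X) (spec_le X) D s"
  shows "s \<in> A"
proof (rule ccontr)
  assume "s \<notin> A"
  then have "s \<in> topspace X - A"
    using s by (simp add: is_sup_on_def)
  moreover have "scott_open_on (topspace X) (spec_le X) (topspace X - A)"
    using X A by (auto simp: d_space_def closedin_def)
  ultimately have "D \<inter> (topspace X - A) \<noteq> {}"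
    using D(1) s unfolding scott_open_on_def by blast
  with D(2) show False by blast
qed

lemma d_space_directed_closedin_eq_principal_closure:
  assumes X: "d_space X" and A: "closedin X A"
    and dir: "directed_on (topspace X) (spec_le X) A"
  shows "\<exists>a\<in>topspace X. A = X closure_of {a}"
proof -
  obtain s where s: "is_sup_on (topspace X) (spec_le X) A s"
    using X dir by (auto simp: d_space_def dcpo_on_def)
  then have sup: "s \<in> topspace X" "\<And>x. x \<in> A \<Longrightarrow> spec_le X x s"
    by (simp_all add: is_sup_on_def)
  have "s \<in> A"
    using d_space_sup_in_closedin[OF X A dir subset_refl s] .
  then have "A = X closure_of {s}"
    using closedin_lower[OF A] sup(2) unfolding spec_le_def by blast
  with sup(1) show ?thesis
    by blast
qed

text \<open>The \<open>T\<^sub>0\<close> axiom supplies the uniqueness of the generic point.\<close>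

lemma sober_space_iff_ex:
  assumes "t0_space X"
  shows "sober_space X \<longleftrightarrow>
    (\<forall>A. irreducible_in X A \<and> closedin X A \<longrightarrow> (\<exists>a\<in>topspace X. A = X closure_of {a}))"
proof -
  have "a = b"
    if "a \<in> topspace X" "b \<in> topspace X" "X closure_of {a} = X closure_of {b}" for a b
    using that spec_le_refl[of a X] spec_le_refl[of b X] spec_le_antisym[OF assms, of a b]
    by (auto simp: spec_le_def)
  then show ?thesis
    unfolding sober_space_def by blast
qed

text \<open>The converse direction evaluates the condition at \<open>K = \<up>x\<close> for some point \<open>x\<close>, because the
  filter property is only asserted together with a member \<open>K\<close> of \<open>H\<close>.\<close>

theorem d_space_sober_iff_Psi_filter:
  assumes X: "d_space X"
    and H: "H \<subseteq> up_sets X"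
    and pr: "\<And>x. x \<in> topspace X \<Longrightarrow> {y. spec_le X x y} \<in> H"
  shows "sober_space X \<longleftrightarrow>
    (\<forall>A K. irreducible_in X A \<and> closedin X A \<and> K \<in> H \<longrightarrow>
       poset_filter_on H (\<subseteq>) (Psi H A) \<and>
       closedin X (lower_closure_on (topspace X) (spec_le X) (A \<inter> K)))" (is "_ \<longleftrightarrow> ?R")
proof -
  have t0: "t0_space X"
    using X by (simp add: d_space_def)
  show ?thesis
  proof
    assume sober: "sober_space X"
    show ?R
    proof (intro allI impI)
      fix A K assume AK: "irreducible_in X A \<and> closedin X A \<and> K \<in> H"
      then obtain a where a: "a \<in> topspace X" "A = X closure_of {a}"
        using sober sober_space_iff_ex[OF t0] by blast
      then show "poset_filter_on H (\<subseteq>) (Psi H A) \<and>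
          closedin X (lower_closure_on (topspace X) (spec_le X) (A \<inter> K))"
        using AK H pr poset_filter_Psi_principal_closure[of H X a]
          closedin_lower_closure_principal_closure_Int[of K X a] by blast
    qed
  next
    assume R: ?R
    have "\<exists>a\<in>topspace X. A = X closure_of {a}" if A: "irreducible_in X A" "closedin X A" for A
    proof -
      have sub: "A \<subseteq> topspace X" "A \<noteq> {}"
        using A by (auto simp: irreducible_in_def)
      then obtain x where "x \<in> topspace X" by blast
      then have "poset_filter_on H (\<subseteq>) (Psi H A)"
        using R A pr by blast
      with pr sub have "directed_on (topspace X) (spec_le X) A"
        by (rule directed_on_if_Psi_filter)
      then show ?thesis
        using d_space_directed_closedin_eq_principal_closure[OF X A(2)] by blast
    qed
    then show "sober_space X"
      using sober_space_iff_ex[OF t0] by blast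
  qed
qed

theorem corollary3p39:
  fixes X :: "'a topology"
  assumes "d_space X"
  shows "(sober_space X \<longleftrightarrow>
            (\<forall>A K. irreducible_in X A \<and> closedin X A \<and> K \<in> up_sets X \<longrightarrow>
               poset_filter_on (up_sets X) (\<subseteq>) (Psi (up_sets X) A) \<and>
               closedin X (lower_closure_on (topspace X) (spec_le X) (A \<inter> K)))) \<and>
         (sober_space X \<longleftrightarrow>
            (\<forall>A K. irreducible_in X A \<and> closedin X A \<and> K \<in> compact_saturated_sets X \<longrightarrow>
               poset_filter_on (compact_saturated_sets X) (\<subseteq>) (Psi (compact_saturated_sets X) A) \<and>
               closedin X (lower_closure_on (topspace X) (spec_le X) (A \<inter> K))))"
  by (intro conjI d_space_sober_iff_Psi_filter assms subset_refl
      compact_saturated_sets_subset_up_sets principal_upper_in_up_sets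
      principal_upper_in_compact_saturated_sets)

end
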